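(* Let $M\ge1$, $R_0>0$ and $c_0>0$. If $\{\Omega_i\}$ is a sequence of $M$-uniform domains in $B_{R_0}\subset\mathbb R^n$ such that $|\Omega_i|\ge c_0>0$ for all $i$ and $\Omega_i\to D$ in $L^1(\mathbb R^n)$ for some set $D$, then there is an $M$-uniform domain $\Omega$ such that $\Omega_i\to\Omega$ in $L^1(\mathbb R^n)$.
   Context: $B_{R_0}$ is the open ball of radius $R_0$ centered at $0$; $|\cdot|$ is Lebesgue measure; a domain is a nonempty connected open set. Convergence of sets $\Omega_i\to D$ in $L^1(\mathbb R^n)$ means $\chi_{\Omega_i}\to\chi_D$ in $L^1(\mathbb R^n)$. For $M\ge 1$, a domain $\Omega\subset\mathbb R^n$ is $M$-uniform if for any $x,y\in\Omega$ there is a rectifiable curve $\gamma:[0,1]\to\Omega$ with $\gamma(0)=x$, $\gamma(1)=y$, $\mathcal H^1(\gamma([0,1]))\le M|x-y|$ and $d(\gamma(t),\partial\Omega)\ge\frac1M\min\{|\gamma(t)-x|,|\gamma(t)-y|\}$ for all $t\in[0,1]$. *)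

theory Defs
  imports "HOL-Analysis.Analysis"
begin

(* One-dimensional Hausdorff measure; the usual normalising factor is 1 in dimension one.
   Boundedness of the covering sets is required explicitly because the real-valued diameter
   carries no information for unbounded sets. *)
definition hausdorff1_delta :: "real \<Rightarrow> 'a::metric_space set \<Rightarrow> ennreal" where
  "hausdorff1_delta \<delta> E =
     (INF U \<in> {U :: nat \<Rightarrow> 'a set. E \<subseteq> (\<Union>j. U j) \<and> (\<forall>j. bounded (U j) \<and> diameter (U j) \<le> \<delta>)}.
        \<Sum>j. ennreal (diameter (U j)))"

definition hausdorff1 :: "'a::metric_space set \<Rightarrow> ennreal" where
  "hausdorff1 E = (SUP \<delta>\<in>{0<..}. hausdorff1_delta \<delta> E)"

definition curve_length :: "(real \<Rightarrow> 'a::metric_space) \<Rightarrow> ennreal" where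
  "curve_length \<gamma> =
     (SUP (k, s) \<in> {(k :: nat, s :: nat \<Rightarrow> real). mono_on {..k} s \<and> s ` {..k} \<subseteq> {0..1}}.
        \<Sum>i<k. ennreal (dist (\<gamma> (s i)) (\<gamma> (s (Suc i)))))"

definition rectifiable_curve :: "(real \<Rightarrow> 'a::metric_space) \<Rightarrow> bool" where
  "rectifiable_curve \<gamma> \<longleftrightarrow> path \<gamma> \<and> curve_length \<gamma> < \<infinity>"

(* Unlike infdist, this is infinite for the empty set, so that the boundary-distance
   condition below is vacuous for a domain without boundary. *)
definition set_distance :: "'a::metric_space \<Rightarrow> 'a set \<Rightarrow> ereal" where
  "set_distance x S = (INF z\<in>S. ereal (dist x z))"

definition domain_set :: "'a::topological_space set \<Rightarrow> bool" where
  "domain_set \<Omega> \<longleftrightarrow> \<Omega> \<noteq> {} \<and> open \<Omega> \<and> connected \<Omega>"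

definition uniform_domain :: "real \<Rightarrow> 'a::metric_space set \<Rightarrow> bool" where
  "uniform_domain M \<Omega> \<longleftrightarrow> domain_set \<Omega> \<and>
     (\<forall>x\<in>\<Omega>. \<forall>y\<in>\<Omega>. \<exists>\<gamma>. rectifiable_curve \<gamma> \<and> \<gamma> ` {0..1} \<subseteq> \<Omega> \<and> \<gamma> 0 = x \<and> \<gamma> 1 = y \<and>
        hausdorff1 (\<gamma> ` {0..1}) \<le> ennreal (M * dist x y) \<and>
        (\<forall>t\<in>{0..1}. set_distance (\<gamma> t) (frontier \<Omega>)
           \<ge> ereal (1 / M * min (dist (\<gamma> t) x) (dist (\<gamma> t) y))))"

(* The integrability clauses say that the characteristic functions belong to L^1; without
   them the Bochner integral below could vanish spuriously. *)
definition L1_set_convergence :: "(nat \<Rightarrow> 'a::euclidean_space set) \<Rightarrow> 'a set \<Rightarrow> bool" where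
  "L1_set_convergence A D \<longleftrightarrow>
     (\<forall>i. integrable lebesgue (indicat_real (A i))) \<and> integrable lebesgue (indicat_real D) \<and>
     (\<lambda>i. LINT x|lebesgue. \<bar>indicat_real (A i) x - indicat_real D x\<bar>) \<longlonglongrightarrow> 0"

end

theory Submission
  imports Defs "HOL-Complex_Analysis.Great_Picard"
begin

text \<open>
  The limit domain is built from the distance functions \<open>d\<^sub>i x = infdist x (- \<Omega>\<^sub>i)\<close>. They are
  1-Lipschitz and uniformly bounded, so by Arzela and Ascoli a subsequence converges to a 1-Lipschitz
  function \<open>d\<close>, and the candidate is \<open>\<Omega> = {x. 0 < d x}\<close>. Two things have to be shown: \<open>\<Omega>\<close>
  satisfies the uniformity condition with the same constant \<open>M\<close>, and \<open>\<Omega>\<close> agrees with \<open>D\<close> up to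
  a null set. The second gives convergence of the whole sequence to \<open>\<Omega>\<close>, because the
  \<open>L\<^sup>1\<close> limit \<open>D\<close> is known for the whole sequence, and it shows that \<open>\<Omega>\<close> is nonempty, because
  the volumes are bounded below.

  Uniformity. The bound on the Hausdorff measure of the image of a curve is not obviously stable
  under limits, so it is first traded for a Lipschitz bound: a curve whose image has measure at most \<open>L\<close> can be
  replaced by an \<open>L\<close>-Lipschitz curve on \<open>{0..1}\<close> with the same endpoints inside its image
  (\<open>path_lipschitz_shortcut\<close>), and conversely the image of an \<open>L\<close>-Lipschitz curve has measure at
  most \<open>L\<close> (\<open>hausdorff1_lipschitz_curve_le\<close>). The first direction takes an arc in the image and
  parametrizes it by the Hausdorff measure of its initial pieces. This reduces the uniformity
  condition, with its exact constant, to one on Lipschitz curves, which is preserved by uniform limits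
  (\<open>uniform_domain_limit\<close>).

  Agreement with \<open>D\<close>. A point of \<open>\<Omega>\<close> lies in \<open>\<Omega>\<^sub>i\<close> for all large \<open>i\<close> of the subsequence,
  whence \<open>\<Omega> - D\<close> is null (\<open>negligible_Diff_if_eventually_covered\<close>). For \<open>D - \<Omega>\<close>
  (\<open>negligible_Diff_uniform_domain_limit\<close>), uniformity and the lower bound on the volume provide
  in every small ball that the domains keep meeting a smaller ball, of comparable radius, inside
  \<open>\<Omega>\<close>. Thus \<open>D - \<Omega>\<close> has density bounded away from one at all of its points and at all small
  scales, and such a set is null by Vitali's covering theorem (\<open>negligible_if_density_le\<close>).
\<close>

section \<open>One-dimensional Hausdorff measure of curves\<close>

lemma hausdorff1_delta_le:
  assumes "E \<subseteq> (\<Union>j. U j)" "\<And>j. bounded (U j)" "\<And>j. diameter (U j) \<le> \<delta>"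
  shows "hausdorff1_delta \<delta> E \<le> (\<Sum>j. ennreal (diameter (U j)))"
  unfolding hausdorff1_delta_def by (rule INF_lower) (use assms in auto)

lemma le_hausdorff1_delta:
  assumes "\<And>U. E \<subseteq> (\<Union>j. U j) \<Longrightarrow> (\<And>j. bounded (U j)) \<Longrightarrow> (\<And>j. diameter (U j) \<le> \<delta>)
             \<Longrightarrow> c \<le> (\<Sum>j::nat. ennreal (diameter (U j)))"
  shows "c \<le> hausdorff1_delta \<delta> E"
  unfolding hausdorff1_delta_def by (rule INF_greatest) (use assms in blast)

lemma hausdorff1_delta_le_hausdorff1: "0 < \<delta> \<Longrightarrow> hausdorff1_delta \<delta> E \<le> hausdorff1 E"
  unfolding hausdorff1_def by (rule SUP_upper) auto

lemma hausdorff1_delta_mono: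
  assumes "E \<subseteq> F" "\<delta>' \<le> \<delta>"
  shows "hausdorff1_delta \<delta> E \<le> hausdorff1_delta \<delta>' F"
proof (rule le_hausdorff1_delta)
  fix U :: "nat \<Rightarrow> 'a set"
  assume "F \<subseteq> (\<Union>j. U j)" "\<And>j. bounded (U j)" "\<And>j. diameter (U j) \<le> \<delta>'"
  with assms show "hausdorff1_delta \<delta> E \<le> (\<Sum>j. ennreal (diameter (U j)))"
    by (intro hausdorff1_delta_le) (auto intro: order_trans[OF _ assms(2)])
qed

lemma hausdorff1_mono: "E \<subseteq> F \<Longrightarrow> hausdorff1 E \<le> hausdorff1 F"
  unfolding hausdorff1_def by (intro SUP_mono) (blast intro: hausdorff1_delta_mono)

lemma bounded_real_subset_Icc_diameter:
  fixes T :: "real set"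
  assumes "bounded T" "T \<noteq> {}"
  shows "T \<subseteq> {Inf T..Sup T}" "Inf T \<le> Sup T" "Sup T - Inf T \<le> diameter T"
proof -
  have bdd: "bdd_above T" "bdd_below T"
    using assms(1) by (auto intro: bounded_imp_bdd_above bounded_imp_bdd_below)
  show "T \<subseteq> {Inf T..Sup T}"
    using bdd by (auto intro: cInf_lower cSup_upper)
  with assms(2) show "Inf T \<le> Sup T" by auto
  have "Sup T \<le> Inf T + diameter T"
  proof (rule cSup_least[OF assms(2)])
    fix x assume x: "x \<in> T"
    have "x - diameter T \<le> Inf T"
    proof (rule cInf_greatest[OF assms(2)])
      fix y assume "y \<in> T"
      with diameter_bounded_bound[OF assms(1) x] show "x - diameter T \<le> y"
        by (fastforce simp: dist_real_def abs_le_iff)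
    qed
    then show "x \<le> Inf T + diameter T" by simp
  qed
  then show "Sup T - Inf T \<le> diameter T" by simp
qed

text \<open>The 1-Lipschitz function \<open>dist a\<close> maps the connected set onto a set containing
  \<open>{0..dist a b}\<close>, and it maps a set of diameter \<open>\<rho>\<close> into an interval of length at most
  \<open>\<rho>\<close>. Hence any cover of the connected set yields a cover of \<open>{0..dist a b}\<close> by intervals,
  and countable subadditivity of Lebesgue measure bounds the sum of the diameters from below.\<close>

lemma dist_le_hausdorff1_connected:
  assumes "connected E" "a \<in> E" "b \<in> E"
  shows "ennreal (dist a b) \<le> hausdorff1 E"
proof -
  have "ennreal (dist a b) \<le> hausdorff1_delta 1 E"
  proof (rule le_hausdorff1_delta)
    fix U :: "nat \<Rightarrow> 'a set"
    assume U: "E \<subseteq> (\<Union>j. U j)" "\<And>j. bounded (U j)"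
    define f where "f = dist a"
    define J where "J j = (if U j = {} then {} else {Inf (f ` U j)..Sup (f ` U j)})" for j
    have bd: "bounded (f ` U j)" for j
    proof -
      obtain B where "\<And>y. y \<in> U j \<Longrightarrow> dist a y \<le> B"
        using U(2)[of j] bounded_any_center[of "U j" a] by auto
      then show ?thesis
        by (intro boundedI[of _ B]) (auto simp: f_def)
    qed
    have diam: "diameter (f ` U j) \<le> diameter (U j)" if "U j \<noteq> {}" for j
    proof (rule diameter_le)
      fix s t assume "s \<in> f ` U j" "t \<in> f ` U j"
      then obtain y z where yz: "y \<in> U j" "z \<in> U j" "s = dist a y" "t = dist a z"
        by (auto simp: f_def)
      have "\<bar>dist a y - dist a z\<bar> \<le> dist y z"
        by (metis abs_dist_diff_le dist_commute)
      also have "\<dots> \<le> diameter (U j)"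
        using U(2) yz by (intro diameter_bounded_bound) auto
      finally show "norm (s - t) \<le> diameter (U j)" using yz by simp
    qed (use that in auto)
    have J: "f ` U j \<subseteq> J j" "emeasure lborel (J j) \<le> ennreal (diameter (U j))" for j
    proof -
      show "f ` U j \<subseteq> J j"
        using bounded_real_subset_Icc_diameter(1)[OF bd, of j] by (simp add: J_def)
      show "emeasure lborel (J j) \<le> ennreal (diameter (U j))"
      proof (cases "U j = {}")
        case False
        then show ?thesis
          using bounded_real_subset_Icc_diameter(2,3)[OF bd, of j] diam[of j]
          by (auto simp: J_def intro!: ennreal_leI)
      qed (simp add: J_def)
    qed
    have "connected (f ` E)"
      unfolding f_def by (intro connected_continuous_image continuous_intros assms)
    moreover have "0 \<in> f ` E" "dist a b \<in> f ` E"
      using assms by (auto simp: f_def image_iff intro: bexI[of _ a])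
    ultimately have "{0..dist a b} \<subseteq> f ` E"
      by (rule connected_contains_Icc)
    also have "\<dots> \<subseteq> (\<Union>j. J j)" using U(1) J(1) by blast
    finally have cov: "{0..dist a b} \<subseteq> (\<Union>j. J j)" .
    have "ennreal (dist a b) = emeasure lborel {0..dist a b}" by simp
    also have "\<dots> \<le> emeasure lborel (\<Union>j. J j)"
      by (intro emeasure_mono cov) (auto simp: J_def)
    also have "\<dots> \<le> (\<Sum>j. emeasure lborel (J j))"
      by (rule emeasure_subadditive_countably) (auto simp: J_def)
    also have "\<dots> \<le> (\<Sum>j. ennreal (diameter (U j)))"
      by (intro suminf_le J(2)) auto
    finally show "ennreal (dist a b) \<le> (\<Sum>j. ennreal (diameter (U j)))" .
  qed
  also have "\<dots> \<le> hausdorff1 E" by (rule hausdorff1_delta_le_hausdorff1) simp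
  finally show ?thesis .
qed

text \<open>A covering set of diameter less than the gap between the two sets meets only one of them, so a
  fine cover of the union splits into a cover of either part.\<close>

lemma hausdorff1_Un_separated_ge:
  assumes "e > 0" and sep: "\<And>a b. a \<in> A \<Longrightarrow> b \<in> B \<Longrightarrow> e \<le> dist a b"
  shows "hausdorff1 A + hausdorff1 B \<le> hausdorff1 (A \<union> B)"
proof -
  have le: "hausdorff1_delta \<delta> A + hausdorff1_delta \<delta> B \<le> hausdorff1 (A \<union> B)" if "\<delta> > 0" for \<delta>
  proof -
    define \<delta>' where "\<delta>' = min \<delta> (e / 2)"
    have \<delta>': "0 < \<delta>'" "\<delta>' \<le> \<delta>" "\<delta>' < e" using that \<open>e > 0\<close> by (auto simp: \<delta>'_def)
    have "hausdorff1_delta \<delta> A + hausdorff1_delta \<delta> B \<le> hausdorff1_delta \<delta>' (A \<union> B)"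
    proof (rule le_hausdorff1_delta)
      fix U :: "nat \<Rightarrow> 'a set"
      assume U: "A \<union> B \<subseteq> (\<Union>j. U j)" "\<And>j. bounded (U j)" "\<And>j. diameter (U j) \<le> \<delta>'"
      have sub: "diameter (U j \<inter> C) \<le> diameter (U j)" for j C
        by (intro diameter_subset U) auto
      have one: "ennreal (diameter (U j \<inter> A)) + ennreal (diameter (U j \<inter> B)) \<le> ennreal (diameter (U j))" for j
      proof (cases "U j \<inter> A = {} \<or> U j \<inter> B = {}")
        case True
        then show ?thesis using sub[of j A] sub[of j B] by (auto intro: ennreal_leI)
      next
        case False
        then obtain a b where ab: "a \<in> U j" "a \<in> A" "b \<in> U j" "b \<in> B" by blast
        then have "e \<le> diameter (U j)"
          using sep[of a b] diameter_bounded_bound[OF U(2), of a j b] by simp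
        with U(3)[of j] \<delta>' show ?thesis by simp
      qed
      have part: "hausdorff1_delta \<delta> C \<le> (\<Sum>j. ennreal (diameter (U j \<inter> C)))" if "C \<subseteq> A \<union> B" for C
      proof (rule hausdorff1_delta_le)
        show "C \<subseteq> (\<Union>j. U j \<inter> C)" using that U(1) by blast
        show "bounded (U j \<inter> C)" for j using U(2) by (rule bounded_subset) auto
        show "diameter (U j \<inter> C) \<le> \<delta>" for j
          using sub[of j C] U(3)[of j] \<delta>'(2) by linarith
      qed
      have "hausdorff1_delta \<delta> A + hausdorff1_delta \<delta> B
          \<le> (\<Sum>j. ennreal (diameter (U j \<inter> A))) + (\<Sum>j. ennreal (diameter (U j \<inter> B)))"
        by (intro add_mono part) auto
      also have "\<dots> = (\<Sum>j. ennreal (diameter (U j \<inter> A)) + ennreal (diameter (U j \<inter> B)))"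
        by (intro suminf_add) auto
      also have "\<dots> \<le> (\<Sum>j. ennreal (diameter (U j)))"
        by (intro suminf_le one) auto
      finally show "hausdorff1_delta \<delta> A + hausdorff1_delta \<delta> B \<le> \<dots>" .
    qed
    also have "\<dots> \<le> hausdorff1 (A \<union> B)" using \<delta>'(1) by (rule hausdorff1_delta_le_hausdorff1)
    finally show ?thesis .
  qed
  have "hausdorff1 A + hausdorff1 B = (SUP \<delta>\<in>{0<..}. hausdorff1_delta \<delta> A + hausdorff1_delta \<delta> B)"
    unfolding hausdorff1_def
  proof (rule SUP_add_directed_ennreal[symmetric])
    fix i j :: real assume ij: "i \<in> {0<..}" "j \<in> {0<..}"
    show "\<exists>k\<in>{0<..}. hausdorff1_delta i A + hausdorff1_delta j B
        \<le> hausdorff1_delta k A + hausdorff1_delta k B"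
      by (rule bexI[of _ "min i j"]) (use ij in \<open>auto intro!: add_mono hausdorff1_delta_mono\<close>)
  qed
  also have "\<dots> \<le> hausdorff1 (A \<union> B)" by (rule SUP_least) (use le in auto)
  finally show ?thesis .
qed

lemma hausdorff1_Un_compact_ge:
  fixes A B :: "'a::heine_borel set"
  assumes "compact A" "compact B" "A \<inter> B = {}"
  shows "hausdorff1 A + hausdorff1 B \<le> hausdorff1 (A \<union> B)"
proof -
  obtain e where "e > 0" "\<And>a b. a \<in> A \<Longrightarrow> b \<in> B \<Longrightarrow> e \<le> dist a b"
    using separate_compact_closed[OF assms(1) compact_imp_closed[OF assms(2)] assms(3)] by blast
  then show ?thesis by (rule hausdorff1_Un_separated_ge)
qed

lemma lipschitz_image_diameter_le:
  fixes h :: "real \<Rightarrow> 'a::metric_space"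
  assumes "L-lipschitz_on {a..b} h" "a \<le> b"
  shows "bounded (h ` {a..b})" "diameter (h ` {a..b}) \<le> L * (b - a)"
proof -
  have L: "L \<ge> 0" using assms(1) by (rule lipschitz_on_nonneg)
  have D: "dist (h s) (h t) \<le> L * (b - a)" if "s \<in> {a..b}" "t \<in> {a..b}" for s t
  proof -
    have "dist (h s) (h t) \<le> L * dist s t" using assms(1) that by (rule lipschitz_onD)
    also have "\<dots> \<le> L * (b - a)"
      using that by (intro mult_left_mono L) (auto simp: dist_real_def)
    finally show ?thesis .
  qed
  show "bounded (h ` {a..b})"
    unfolding bounded_def using D by (auto intro!: exI[of _ "h a"] exI[of _ "L * (b - a)"] simp: assms)
  show "diameter (h ` {a..b}) \<le> L * (b - a)"
    unfolding diameter_def using assms(2) D L by (auto intro!: cSUP_least)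
qed

text \<open>The images of \<open>N\<close> equal subintervals have diameters at most \<open>L / N\<close>, whatever \<open>N\<close> is.\<close>

lemma hausdorff1_lipschitz_curve_le:
  fixes h :: "real \<Rightarrow> 'a::metric_space"
  assumes h: "L-lipschitz_on {0..1} h"
  shows "hausdorff1 (h ` {0..1}) \<le> ennreal L"
  unfolding hausdorff1_def
proof (rule SUP_least)
  fix \<delta> :: real assume "\<delta> \<in> {0<..}"
  then have "\<delta> > 0" by simp
  have L: "L \<ge> 0" using h by (rule lipschitz_on_nonneg)
  obtain N :: nat where N: "N > 0" "L / real N \<le> \<delta>"
  proof -
    obtain N :: nat where "L / \<delta> < real N" using reals_Archimedean2 by blast
    moreover have "L / \<delta> \<ge> 0" using L \<open>\<delta> > 0\<close> by simp
    ultimately have "N > 0" by (auto intro!: gr0I)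
    moreover from this have "L / real N \<le> \<delta>"
      using \<open>L / \<delta> < real N\<close> \<open>\<delta> > 0\<close> by (simp add: field_simps)
    ultimately show ?thesis using that by blast
  qed
  define U where "U j = (if j < N then h ` {real j / real N..real (Suc j) / real N} else {})" for j
  have sub: "{real j / real N..real (Suc j) / real N} \<subseteq> {0..1}" if "j < N" for j
  proof -
    have "real (Suc j) / real N \<le> 1" using that N by (simp add: field_simps)
    moreover have "0 \<le> real j / real N" by simp
    ultimately show ?thesis by (meson atLeastatMost_subset_iff)
  qed
  have U: "bounded (U j)" "diameter (U j) \<le> (if j < N then L / real N else 0)" for j
  proof -
    have le: "real j / real N \<le> real (Suc j) / real N" by (simp add: divide_right_mono)
    have "L * (real (Suc j) / real N - real j / real N) = L / real N"
      using N by (simp add: field_simps)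
    with lipschitz_image_diameter_le[of L "real j / real N" "real (Suc j) / real N" h, OF lipschitz_on_subset[OF h sub] le]
    show "bounded (U j)" "diameter (U j) \<le> (if j < N then L / real N else 0)"
      by (auto simp: U_def)
  qed
  have cov: "h ` {0..1} \<subseteq> (\<Union>j. U j)"
  proof
    fix y assume "y \<in> h ` {0..1}"
    then obtain t where t: "t \<in> {0..1}" "y = h t" by auto
    have "\<exists>j<N. t \<in> {real j / real N..real (Suc j) / real N}"
    proof (cases "t = 1")
      case True
      with N show ?thesis by (intro exI[of _ "N - 1"]) (auto simp: of_nat_diff)
    next
      case False
      define j where "j = nat \<lfloor>t * real N\<rfloor>"
      have nn: "0 \<le> t * real N" using t by auto
      then have j: "real j \<le> t * real N" "t * real N \<le> real (Suc j)"
        unfolding j_def by linarith+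
      have "t * real N < real N" using False t N by auto
      with j have "j < N" by linarith
      moreover have "t \<in> {real j / real N..real (Suc j) / real N}"
        using j N(1) by (auto simp: field_simps)
      ultimately show ?thesis by blast
    qed
    then show "y \<in> (\<Union>j. U j)" using t by (auto simp: U_def)
  qed
  have "hausdorff1_delta \<delta> (h ` {0..1}) \<le> (\<Sum>j. ennreal (diameter (U j)))"
  proof (rule hausdorff1_delta_le[OF cov U(1)])
    show "diameter (U j) \<le> \<delta>" for j
      using U(2)[of j] N(2) \<open>\<delta> > 0\<close> by (auto split: if_splits)
  qed
  also have "\<dots> = (\<Sum>j<N. ennreal (diameter (U j)))"
    by (intro suminf_finite) (auto simp: U_def)
  also have "\<dots> \<le> (\<Sum>j<N. ennreal (L / real N))"
  proof (intro sum_mono ennreal_leI)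
    show "diameter (U j) \<le> L / real N" if "j \<in> {..<N}" for j
      using U(2)[of j] that by simp
  qed
  also have "\<dots> = ennreal L"
    using N(1) L by (subst sum_ennreal) auto
  finally show "hausdorff1_delta \<delta> (h ` {0..1}) \<le> ennreal L" .
qed

lemma curve_length_lipschitz_le:
  fixes h :: "real \<Rightarrow> 'a::metric_space"
  assumes h: "L-lipschitz_on {0..1} h"
  shows "curve_length h \<le> ennreal L"
  unfolding curve_length_def
proof (rule SUP_least, clarify)
  fix k :: nat and s :: "nat \<Rightarrow> real"
  assume s: "mono_on {..k} s" "s ` {..k} \<subseteq> {0..1}"
  have L: "L \<ge> 0" using h by (rule lipschitz_on_nonneg)
  have in01: "s i \<in> {0..1}" if "i \<le> k" for i using s(2) that by auto
  have "(\<Sum>i<k. dist (h (s i)) (h (s (Suc i)))) \<le> (\<Sum>i<k. L * (s (Suc i) - s i))"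
  proof (rule sum_mono)
    fix i assume i: "i \<in> {..<k}"
    have "s i \<le> s (Suc i)" by (rule mono_onD[OF s(1)]) (use i in auto)
    with lipschitz_onD[OF h, of "s i" "s (Suc i)"] in01[of i] in01[of "Suc i"] i
    show "dist (h (s i)) (h (s (Suc i))) \<le> L * (s (Suc i) - s i)"
      by (simp add: dist_real_def)
  qed
  also have "\<dots> = L * (s k - s 0)"
    by (simp add: sum_distrib_left[symmetric] sum_lessThan_telescope)
  also have "\<dots> \<le> L * 1"
    using in01[of k] in01[of 0] by (intro mult_left_mono L) auto
  finally have "(\<Sum>i<k. dist (h (s i)) (h (s (Suc i)))) \<le> L" by simp
  then show "(\<Sum>i<k. ennreal (dist (h (s i)) (h (s (Suc i))))) \<le> ennreal L"
    by (subst sum_ennreal) (auto intro: ennreal_leI)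
qed

lemma rectifiable_lipschitz_curve:
  fixes h :: "real \<Rightarrow> 'a::metric_space"
  assumes "L-lipschitz_on {0..1} h"
  shows "rectifiable_curve h"
proof -
  have "path h" unfolding path_def using assms by (rule lipschitz_on_continuous_on)
  moreover have "curve_length h < \<infinity>"
    using curve_length_lipschitz_le[OF assms] by (simp add: le_less_trans[OF _ ennreal_less_top])
  ultimately show ?thesis by (simp add: rectifiable_curve_def)
qed

section \<open>Short curves from Hausdorff measure\<close>

text \<open>Injectivity makes \<open>g ` {0..s}\<close> and \<open>g ` {u..t}\<close> disjoint compact sets whenever \<open>s < u\<close>,
  so their measures add; the second is connected and so has measure at least \<open>dist (g u) (g t)\<close>.
  The claim follows as \<open>u\<close> decreases to \<open>s\<close>.\<close>

lemma hausdorff1_arc_increment: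
  fixes g :: "real \<Rightarrow> 'a::euclidean_space"
  assumes "arc g" "0 \<le> s" "s \<le> t" "t \<le> 1"
  shows "hausdorff1 (g ` {0..s}) + ennreal (dist (g s) (g t)) \<le> hausdorff1 (g ` {0..t})"
proof (cases "s = t")
  case False
  with assms have "s < t" by simp
  have cont: "continuous_on {0..1} g" and inj: "inj_on g {0..1}"
    using assms(1) by (auto simp: arc_def path_def)
  have cpt: "compact (g ` {a..b})" if "0 \<le> a" "b \<le> 1" for a b
    using that by (intro compact_continuous_image continuous_on_subset[OF cont]) auto
  have step: "hausdorff1 (g ` {0..s}) + ennreal (dist (g u) (g t)) \<le> hausdorff1 (g ` {0..t})"
    if u: "s < u" "u \<le> t" for u
  proof -
    have "ennreal (dist (g u) (g t)) \<le> hausdorff1 (g ` {u..t})"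
    proof (rule dist_le_hausdorff1_connected)
      show "connected (g ` {u..t})"
        using u assms by (intro connected_continuous_image continuous_on_subset[OF cont]) auto
    qed (use u in auto)
    then have "hausdorff1 (g ` {0..s}) + ennreal (dist (g u) (g t))
        \<le> hausdorff1 (g ` {0..s}) + hausdorff1 (g ` {u..t})"
      by (rule add_left_mono)
    also have "\<dots> \<le> hausdorff1 (g ` {0..s} \<union> g ` {u..t})"
    proof (rule hausdorff1_Un_compact_ge)
      show "g ` {0..s} \<inter> g ` {u..t} = {}"
        using inj u assms by (subst inj_on_image_Int[OF inj, symmetric]) auto
    qed (use u assms in \<open>auto intro!: cpt\<close>)
    also have "\<dots> \<le> hausdorff1 (g ` {0..t})"
      using u assms by (intro hausdorff1_mono) auto
    finally show ?thesis .
  qed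
  show ?thesis
  proof (rule tendsto_upperbound)
    have "((\<lambda>u. g u) \<longlongrightarrow> g s) (at s within {s<..t})"
    proof -
      have "(g \<longlongrightarrow> g s) (at s within {0..1})"
        using cont assms by (auto simp: continuous_on_def)
      then show ?thesis by (rule tendsto_within_subset) (use assms in auto)
    qed
    then show "((\<lambda>u. hausdorff1 (g ` {0..s}) + ennreal (dist (g u) (g t)))
        \<longlongrightarrow> hausdorff1 (g ` {0..s}) + ennreal (dist (g s) (g t))) (at s within {s<..t})"
      by (intro tendsto_add tendsto_const tendsto_ennrealI tendsto_dist)
    show "\<forall>\<^sub>F u in at s within {s<..t}.
        hausdorff1 (g ` {0..s}) + ennreal (dist (g u) (g t)) \<le> hausdorff1 (g ` {0..t})"
      using step by (auto simp: eventually_at_filter)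
    show "at s within {s<..t} \<noteq> bot"
      using \<open>s < t\<close> by (simp add: at_within_eq_bot_iff)
  qed
qed simp

text \<open>The function \<open>V t = hausdorff1 (g ` {0..t})\<close> plays the part of arc length: by the preceding
  lemma, its increments dominate the distances between points of the arc. At time \<open>v\<close> the new
  curve sits at the supremum of the parameters where \<open>V\<close> is at most \<open>L * v\<close>. Strictly between the
  parameters reached at times \<open>v < w\<close>, the values of \<open>V\<close> stay within \<open>{L * v..L * w}\<close>, which
  bounds the distances there by \<open>L * (w - v)\<close>; the continuity of \<open>g\<close> extends this estimate to the
  two end parameters.\<close>

lemma arc_lipschitz_reparametrization:
  fixes g :: "real \<Rightarrow> 'a::euclidean_space"
  assumes g: "arc g" and len: "hausdorff1 (path_image g) \<le> ennreal L" and "0 \<le> L"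
  obtains h :: "real \<Rightarrow> 'a" where "L-lipschitz_on {0..1} h" "h 0 = pathstart g" "h 1 = pathfinish g"
    "h ` {0..1} \<subseteq> path_image g"
proof -
  have cont: "continuous_on {0..1} g" and inj: "inj_on g {0..1}"
    using g by (auto simp: arc_def path_def)
  define V where "V t = enn2real (hausdorff1 (g ` {0..t}))" for t
  have fin: "hausdorff1 (g ` {0..t}) \<le> ennreal L" if "t \<le> 1" for t
  proof -
    have "hausdorff1 (g ` {0..t}) \<le> hausdorff1 (path_image g)"
      using that by (intro hausdorff1_mono) (auto simp: path_image_def)
    with len show ?thesis by (rule order_trans[rotated])
  qed
  have V: "ennreal (V t) = hausdorff1 (g ` {0..t})" if "t \<le> 1" for t
    unfolding V_def using fin[OF that] by (simp add: le_less_trans[OF _ ennreal_less_top])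
  have V_nonneg: "0 \<le> V t" for t by (simp add: V_def)
  have V_le: "V t \<le> L" if "t \<le> 1" for t
    using fin[OF that] V[OF that] \<open>0 \<le> L\<close> by (metis ennreal_le_iff)
  have incr: "dist (g s) (g t) \<le> V t - V s" if "0 \<le> s" "s \<le> t" "t \<le> 1" for s t
  proof -
    have "ennreal (V s + dist (g s) (g t)) \<le> ennreal (V t)"
      using hausdorff1_arc_increment[OF g that] that by (simp add: V V_nonneg ennreal_plus)
    then have "V s + dist (g s) (g t) \<le> V t" using V_nonneg by (subst (asm) ennreal_le_iff) auto
    then show ?thesis by simp
  qed
  then have V_mono: "V s \<le> V t" if "0 \<le> s" "s \<le> t" "t \<le> 1" for s t
    using that by (smt (verit) zero_le_dist)
  have "V 0 = 0"
  proof -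
    \<comment> \<open>A point is the image of a 0-Lipschitz curve.\<close>
    have "hausdorff1 ((\<lambda>_. g 0) ` {0..1::real}) \<le> ennreal 0"
      by (intro hausdorff1_lipschitz_curve_le lipschitz_onI) auto
    then show ?thesis by (simp add: V_def image_constant_conv)
  qed
  define A where "A v = {t \<in> {0..1}. V t \<le> L * v}" for v
  define \<tau> where "\<tau> v = Sup (A v)" for v
  have A0: "0 \<in> A v" if "0 \<le> v" for v
    using that \<open>V 0 = 0\<close> \<open>0 \<le> L\<close> by (simp add: A_def)
  have A_bdd: "bdd_above (A v)" for v by (rule bdd_aboveI[of _ 1]) (simp add: A_def)
  have \<tau>: "\<tau> v \<in> {0..1}" if "0 \<le> v" for v
  proof -
    have "0 \<le> \<tau> v" unfolding \<tau>_def by (rule cSup_upper[OF A0[OF that] A_bdd])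
    moreover have "\<tau> v \<le> 1"
      unfolding \<tau>_def
    proof (rule cSup_least)
      show "A v \<noteq> {}" using A0[OF that] by blast
    qed (simp add: A_def)
    ultimately show ?thesis by simp
  qed
  have above: "L * v < V s" if "\<tau> v < s" "s \<le> 1" "0 \<le> v" for v s
  proof (rule ccontr)
    assume "\<not> L * v < V s"
    then have "s \<in> A v" using that \<tau>[of v] by (auto simp: A_def)
    then have "s \<le> \<tau> v" unfolding \<tau>_def by (intro cSup_upper A_bdd)
    with that show False by simp
  qed
  have below: "V s \<le> L * v" if s: "0 \<le> s" "s < \<tau> v" "0 \<le> v" for v s
  proof -
    obtain t where "t \<in> A v" "s < t"
      using s(2) A0[OF s(3)] A_bdd[of v] less_cSup_iff[of "A v" s] unfolding \<tau>_def by auto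
    then show ?thesis using V_mono[of s t] s by (auto simp: A_def)
  qed
  have lip: "dist (g (\<tau> v)) (g (\<tau> w)) \<le> L * (w - v)" if vw: "0 \<le> v" "v \<le> w" for v w
  proof -
    have "A v \<subseteq> A w"
      using vw \<open>0 \<le> L\<close> by (auto simp: A_def intro: order_trans mult_left_mono)
    then have le: "\<tau> v \<le> \<tau> w"
      unfolding \<tau>_def using A0[OF vw(1)] A_bdd by (intro cSup_subset_mono) auto
    show ?thesis
    proof (cases "\<tau> v = \<tau> w")
      case True
      then show ?thesis using vw \<open>0 \<le> L\<close> by simp
    next
      case False
      with le have less: "\<tau> v < \<tau> w" by simp
      have range: "\<tau> v \<in> {0..1}" "\<tau> w \<in> {0..1}" using \<tau> vw by auto
      define I where "I = {\<tau> v<..<\<tau> w}"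
      have cl: "closure I = {\<tau> v..\<tau> w}" using less by (simp add: I_def)
      have cont': "continuous_on (closure I) g"
        unfolding cl using range by (intro continuous_on_subset[OF cont]) auto
      have inner: "dist (g s) (g t) \<le> L * (w - v)" if "s \<in> I" "t \<in> I" for s t
      proof -
        have *: "dist (g s) (g t) \<le> L * (w - v)" if "s \<in> I" "t \<in> I" "s \<le> t" for s t
          using that range incr[of s t] above[of v s] below[of t w] vw
          by (auto simp: I_def algebra_simps)
        show ?thesis using *[of s t] *[of t s] that by (cases "s \<le> t") (auto simp: dist_commute)
      qed
      have half: "dist (g s) (g (\<tau> w)) \<le> L * (w - v)" if "s \<in> I" for s
        by (rule continuous_le_on_closure[of I "\<lambda>t. dist (g s) (g t)"])
          (use inner that cl less in \<open>auto intro!: continuous_intros cont'[unfolded cl]\<close>)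
      show ?thesis
        by (rule continuous_le_on_closure[of I "\<lambda>s. dist (g s) (g (\<tau> w))"])
          (use half cl less in \<open>auto intro!: continuous_intros cont'[unfolded cl]\<close>)
    qed
  qed
  show ?thesis
  proof (rule that[of "\<lambda>v. g (\<tau> v)"])
    show "L-lipschitz_on {0..1} (\<lambda>v. g (\<tau> v))"
    proof (rule lipschitz_onI)
      fix v w :: real assume "v \<in> {0..1}" "w \<in> {0..1}"
      then show "dist (g (\<tau> v)) (g (\<tau> w)) \<le> L * dist v w"
        using lip[of v w] lip[of w v]
        by (cases "v \<le> w") (auto simp: dist_real_def dist_commute)
    qed fact
    have "A 0 = {0}"
    proof -
      have "t = 0" if "t \<in> A 0" for t
      proof -
        have t: "t \<in> {0..1}" "V t \<le> 0" using that by (auto simp: A_def)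
        have "dist (g 0) (g t) \<le> V t - V 0" by (rule incr) (use t in auto)
        with t \<open>V 0 = 0\<close> have "dist (g 0) (g t) \<le> 0" by linarith
        then have "g t = g 0" by simp
        with t inj show ?thesis by (auto dest: inj_onD)
      qed
      with A0[of 0] show ?thesis by auto
    qed
    then show "g (\<tau> 0) = pathstart g" by (simp add: \<tau>_def pathstart_def)
    have "1 \<in> A 1" using V_le[of 1] by (auto simp: A_def)
    then have "1 \<le> \<tau> 1" unfolding \<tau>_def by (intro cSup_upper A_bdd)
    with \<tau>[of 1] show "g (\<tau> 1) = pathfinish g" by (simp add: pathfinish_def)
    show "(\<lambda>v. g (\<tau> v)) ` {0..1} \<subseteq> path_image g"
      using \<tau> by (auto simp: path_image_def)
  qed
qed

text \<open>The Hausdorff measure of the image of a path can be much smaller than its length, because the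
  path may retrace itself. Passing to an arc inside the image removes the repetitions.\<close>

lemma path_lipschitz_shortcut:
  fixes \<gamma> :: "real \<Rightarrow> 'a::euclidean_space"
  assumes \<gamma>: "path \<gamma>" and len: "hausdorff1 (path_image \<gamma>) \<le> ennreal L" and "0 \<le> L"
  obtains h :: "real \<Rightarrow> 'a" where "L-lipschitz_on {0..1} h" "h 0 = pathstart \<gamma>" "h 1 = pathfinish \<gamma>"
    "h ` {0..1} \<subseteq> path_image \<gamma>"
proof (cases "pathstart \<gamma> = pathfinish \<gamma>")
  case True
  show ?thesis
    by (rule that[of "\<lambda>_. pathstart \<gamma>"]) (use True \<open>0 \<le> L\<close> in \<open>auto intro!: lipschitz_onI\<close>)
next
  case False
  obtain g where g: "arc g" "path_image g \<subseteq> path_image \<gamma>"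
      "pathstart g = pathstart \<gamma>" "pathfinish g = pathfinish \<gamma>"
    using path_contains_arc[OF \<gamma> refl refl False] by blast
  have "hausdorff1 (path_image g) \<le> ennreal L"
    using hausdorff1_mono[OF g(2)] len by (rule order_trans)
  then obtain h :: "real \<Rightarrow> 'a" where "L-lipschitz_on {0..1} h" "h 0 = pathstart g" "h 1 = pathfinish g"
    "h ` {0..1} \<subseteq> path_image g"
    using arc_lipschitz_reparametrization[OF g(1) _ \<open>0 \<le> L\<close>] by blast
  with g show ?thesis by (intro that[of h]) auto
qed

section \<open>Uniform domains and Lipschitz curves\<close>

lemma le_set_distance_iff: "ereal a \<le> set_distance p S \<longleftrightarrow> (\<forall>z\<in>S. a \<le> dist p z)"
  by (simp add: set_distance_def le_INF_iff)

lemma le_infdist_iff: "S \<noteq> {} \<Longrightarrow> a \<le> infdist p S \<longleftrightarrow> (\<forall>z\<in>S. a \<le> dist p z)"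
  by (auto simp: infdist_notempty intro: cINF_greatest order_trans[OF _ cINF_lower])

text \<open>A segment from a point of \<open>\<Omega>\<close> to a point outside crosses the frontier, so within
  \<open>\<Omega>\<close> the distance to the frontier is the distance to the complement. The latter is the one
  that depends continuously on the point in the whole space.\<close>

lemma le_infdist_Compl_if_le_set_distance_frontier:
  fixes \<Omega> :: "'a::real_normed_vector set"
  assumes "p \<in> \<Omega>" "\<Omega> \<noteq> UNIV" "ereal a \<le> set_distance p (frontier \<Omega>)"
  shows "a \<le> infdist p (- \<Omega>)"
proof -
  have "a \<le> dist p z" if "z \<in> - \<Omega>" for z
  proof -
    have "closed_segment p z \<inter> frontier \<Omega> \<noteq> {}"
      using assms(1) that by (intro connected_Int_frontier) auto
    then obtain w where w: "w \<in> closed_segment p z" "w \<in> frontier \<Omega>" by blast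
    have "a \<le> dist p w" using assms(3) w(2) by (simp add: le_set_distance_iff)
    also have "\<dots> \<le> dist p z" using segment_bound(1)[OF w(1)] by (simp add: dist_norm norm_minus_commute)
    finally show ?thesis .
  qed
  with assms(2) show ?thesis by (subst le_infdist_iff) auto
qed

text \<open>Replacing the curve by a subset of its image preserves the distance condition, since that
  condition only concerns the points on the curve and the two endpoints.\<close>

lemma uniform_domain_lipschitz_curve:
  fixes \<Omega> :: "'a::euclidean_space set"
  assumes \<Omega>: "uniform_domain M \<Omega>" "\<Omega> \<noteq> UNIV" and "0 \<le> M" and xy: "x \<in> \<Omega>" "y \<in> \<Omega>"
  obtains h :: "real \<Rightarrow> 'a" where "(M * dist x y)-lipschitz_on {0..1} h" "h 0 = x" "h 1 = y"
    "h ` {0..1} \<subseteq> \<Omega>"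
    "\<And>t. t \<in> {0..1} \<Longrightarrow> 1 / M * min (dist (h t) x) (dist (h t) y) \<le> infdist (h t) (- \<Omega>)"
proof -
  obtain \<gamma> where \<gamma>: "rectifiable_curve \<gamma>" "\<gamma> ` {0..1} \<subseteq> \<Omega>" "\<gamma> 0 = x" "\<gamma> 1 = y"
      "hausdorff1 (\<gamma> ` {0..1}) \<le> ennreal (M * dist x y)"
      "\<forall>t\<in>{0..1}. set_distance (\<gamma> t) (frontier \<Omega>)
           \<ge> ereal (1 / M * min (dist (\<gamma> t) x) (dist (\<gamma> t) y))"
    using \<Omega>(1) xy unfolding uniform_domain_def by blast
  obtain h :: "real \<Rightarrow> 'a" where h: "(M * dist x y)-lipschitz_on {0..1} h" "h 0 = x" "h 1 = y"
      "h ` {0..1} \<subseteq> path_image \<gamma>"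
    by (rule path_lipschitz_shortcut[of \<gamma> "M * dist x y"])
      (use \<gamma> \<open>0 \<le> M\<close> in \<open>auto simp: rectifiable_curve_def path_image_def pathstart_def pathfinish_def\<close>)
  show ?thesis
  proof (rule that[OF h(1-3)])
    show "h ` {0..1} \<subseteq> \<Omega>" using h(4) \<gamma>(2) by (auto simp: path_image_def)
    fix t :: real assume "t \<in> {0..1}"
    with h(4) have "h t \<in> \<gamma> ` {0..1}" by (auto simp: path_image_def)
    then obtain s where s: "s \<in> {0..1}" "h t = \<gamma> s" by blast
    show "1 / M * min (dist (h t) x) (dist (h t) y) \<le> infdist (h t) (- \<Omega>)"
      unfolding s(2)
      by (rule le_infdist_Compl_if_le_set_distance_frontier[OF _ \<Omega>(2)]) (use s \<gamma> in auto)
  qed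
qed

lemma uniform_domain_if_lipschitz_curves:
  fixes \<Omega> :: "'a::euclidean_space set"
  assumes "open \<Omega>" "\<Omega> \<noteq> {}"
    and curves: "\<And>x y. x \<in> \<Omega> \<Longrightarrow> y \<in> \<Omega> \<Longrightarrow>
      \<exists>h :: real \<Rightarrow> 'a. (M * dist x y)-lipschitz_on {0..1} h \<and> h 0 = x \<and> h 1 = y \<and> h ` {0..1} \<subseteq> \<Omega> \<and>
        (\<forall>t\<in>{0..1}. \<forall>z\<in>frontier \<Omega>. 1 / M * min (dist (h t) x) (dist (h t) y) \<le> dist (h t) z)"
  shows "uniform_domain M \<Omega>"
proof -
  have pc: "path_connected \<Omega>"
    unfolding path_connected_def
  proof (intro ballI)
    fix x y assume "x \<in> \<Omega>" "y \<in> \<Omega>"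
    then obtain h :: "real \<Rightarrow> 'a" where "(M * dist x y)-lipschitz_on {0..1} h" "h 0 = x" "h 1 = y"
        "h ` {0..1} \<subseteq> \<Omega>"
      using curves by blast
    then show "\<exists>g. path g \<and> path_image g \<subseteq> \<Omega> \<and> pathstart g = x \<and> pathfinish g = y"
      by (intro exI[of _ h])
        (auto simp: path_def path_image_def pathstart_def pathfinish_def lipschitz_on_continuous_on)
  qed
  have "domain_set \<Omega>"
    using assms(1,2) pc by (simp add: domain_set_def path_connected_imp_connected)
  moreover have "\<exists>\<gamma>. rectifiable_curve \<gamma> \<and> \<gamma> ` {0..1} \<subseteq> \<Omega> \<and> \<gamma> 0 = x \<and> \<gamma> 1 = y \<and>
        hausdorff1 (\<gamma> ` {0..1}) \<le> ennreal (M * dist x y) \<and>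
        (\<forall>t\<in>{0..1}. set_distance (\<gamma> t) (frontier \<Omega>)
           \<ge> ereal (1 / M * min (dist (\<gamma> t) x) (dist (\<gamma> t) y)))"
    if xy: "x \<in> \<Omega>" "y \<in> \<Omega>" for x y
  proof -
    obtain h :: "real \<Rightarrow> 'a" where h: "(M * dist x y)-lipschitz_on {0..1} h" "h 0 = x" "h 1 = y"
        "h ` {0..1} \<subseteq> \<Omega>"
        "\<forall>t\<in>{0..1}. \<forall>z\<in>frontier \<Omega>. 1 / M * min (dist (h t) x) (dist (h t) y) \<le> dist (h t) z"
      using curves[OF xy] by blast
    show ?thesis
      unfolding le_set_distance_iff
      by (intro exI[of _ h] conjI rectifiable_lipschitz_curve[OF h(1)]
          hausdorff1_lipschitz_curve_le[OF h(1)] h)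
  qed
  ultimately show ?thesis unfolding uniform_domain_def by blast
qed

text \<open>A point of the curve from \<open>z\<close> to \<open>w\<close> at distance \<open>r / 4\<close> from \<open>z\<close> is still far from
  \<open>w\<close>, and so the uniformity condition keeps it away from the complement.\<close>

lemma uniform_domain_corkscrew:
  fixes \<Omega> :: "'a::euclidean_space set"
  assumes \<Omega>: "uniform_domain M \<Omega>" "\<Omega> \<noteq> UNIV" and "0 < M"
    and zw: "z \<in> \<Omega>" "w \<in> \<Omega>" and r: "0 < r" "r \<le> dist z w"
  obtains p where "dist z p = r / 4" "r / (4 * M) \<le> infdist p (- \<Omega>)"
proof -
  obtain h :: "real \<Rightarrow> 'a" where h: "(M * dist z w)-lipschitz_on {0..1} h" "h 0 = z" "h 1 = w"
    "\<And>t. t \<in> {0..1} \<Longrightarrow> 1 / M * min (dist (h t) z) (dist (h t) w) \<le> infdist (h t) (- \<Omega>)"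
    using uniform_domain_lipschitz_curve[OF \<Omega> less_imp_le[OF \<open>0 < M\<close>] zw] by metis
  have cont: "continuous_on {0..1} h" using h(1) by (rule lipschitz_on_continuous_on)
  have "\<exists>t. 0 \<le> t \<and> t \<le> 1 \<and> dist z (h t) = r / 4"
    by (rule IVT') (use h r in \<open>auto intro!: continuous_intros cont\<close>)
  then obtain t where t: "t \<in> {0..1}" "dist z (h t) = r / 4" by auto
  have "dist z w \<le> dist z (h t) + dist (h t) w" by (rule dist_triangle)
  with t r have "r / 4 \<le> min (dist (h t) z) (dist (h t) w)" by (simp add: dist_commute)
  then have "1 / M * (r / 4) \<le> 1 / M * min (dist (h t) z) (dist (h t) w)"
    using \<open>0 < M\<close> by (intro mult_left_mono) auto
  also have "\<dots> \<le> infdist (h t) (- \<Omega>)" using t(1) by (rule h(4))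
  finally show ?thesis using that[OF t(2)] by (simp add: mult.commute)
qed

section \<open>Limits of uniform domains\<close>

lemma lipschitz_sequence_convergent_subsequence:
  fixes F :: "nat \<Rightarrow> 'a::euclidean_space \<Rightarrow> 'b::{real_normed_vector,heine_borel}"
  assumes "compact S" and lip: "\<And>n. L-lipschitz_on S (F n)"
    and bdd: "\<And>n x. x \<in> S \<Longrightarrow> norm (F n x) \<le> B"
  obtains g and k :: "nat \<Rightarrow> nat" where "strict_mono k" "L-lipschitz_on S g"
    "\<And>x. x \<in> S \<Longrightarrow> (\<lambda>n. F (k n) x) \<longlonglongrightarrow> g x"
proof -
  have L: "0 \<le> L" using lip[of 0] by (rule lipschitz_on_nonneg)
  obtain g and k where k: "strict_mono (k :: nat \<Rightarrow> nat)"
    and unif: "\<And>e. 0 < e \<Longrightarrow> \<exists>N. \<forall>n x. n \<ge> N \<and> x \<in> S \<longrightarrow> norm (F (k n) x - g x) < e"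
  proof (rule Arzela_Ascoli[OF \<open>compact S\<close> bdd])
    fix x :: 'a and e :: real assume x: "x \<in> S" and "0 < e"
    show "\<exists>d. 0 < d \<and> (\<forall>n y. y \<in> S \<and> norm (x - y) < d \<longrightarrow> norm (F n x - F n y) < e)"
    proof (intro exI conjI allI impI)
      show "0 < e / (L + 1)" using \<open>0 < e\<close> L by simp
      fix n y assume y: "y \<in> S \<and> norm (x - y) < e / (L + 1)"
      have "norm (F n x - F n y) \<le> L * norm (x - y)"
        using lipschitz_onD[OF lip x, of y n] y by (simp add: dist_norm)
      also have "\<dots> \<le> (L + 1) * norm (x - y)" by (simp add: mult_right_mono)
      also have "\<dots> < e" using y L by (simp add: field_simps)
      finally show "norm (F n x - F n y) < e" .
    qed
  qed blast+
  have lim: "(\<lambda>n. F (k n) x) \<longlonglongrightarrow> g x" if "x \<in> S" for x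
    by (rule LIMSEQ_I) (use unif that in blast)
  have "L-lipschitz_on S g"
  proof (rule lipschitz_onI[OF _ L])
    fix x y assume xy: "x \<in> S" "y \<in> S"
    have "(\<lambda>n. dist (F (k n) x) (F (k n) y)) \<longlonglongrightarrow> dist (g x) (g y)"
      by (intro tendsto_dist lim xy)
    then show "dist (g x) (g y) \<le> L * dist x y"
      by (rule LIMSEQ_le_const2) (use lipschitz_onD[OF lip xy] in auto)
  qed
  from that[OF k this lim] show ?thesis by blast
qed

lemma infdist_limit_lipschitz:
  fixes d :: "'a::metric_space \<Rightarrow> real"
  assumes d: "\<And>x. (\<lambda>i. infdist x (S i)) \<longlonglongrightarrow> d x"
  shows "\<bar>d x - d y\<bar> \<le> dist x y"
  by (rule LIMSEQ_le_const2[OF tendsto_rabs[OF tendsto_diff[OF d d]]])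
    (use infdist_triangle_abs in auto)

lemma open_positive_infdist_limit:
  fixes d :: "'a::metric_space \<Rightarrow> real"
  assumes d: "\<And>x. (\<lambda>i. infdist x (S i)) \<longlonglongrightarrow> d x"
  shows "open {x. 0 < d x}"
proof -
  have "1-lipschitz_on UNIV d"
    by (rule lipschitz_onI) (use infdist_limit_lipschitz[OF d] in \<open>auto simp: dist_real_def\<close>)
  then have "continuous_on UNIV d" by (rule lipschitz_on_continuous_on)
  then show ?thesis by (intro open_Collect_less) auto
qed

lemma eventually_mem_if_infdist_limit_pos:
  assumes "\<And>x. (\<lambda>i. infdist x (- A i)) \<longlonglongrightarrow> d x" "0 < d x"
  shows "\<forall>\<^sub>F i in sequentially. x \<in> A i"
proof -
  have "\<forall>\<^sub>F i in sequentially. 0 < infdist x (- A i)"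
    by (rule order_tendstoD(1)[OF assms])
  then show ?thesis by eventually_elim (metis ComplI infdist_zero less_irrefl)
qed

text \<open>The Lipschitz curves joining \<open>x\<close> to \<open>y\<close> in the approximating domains have the common
  constant \<open>M * dist x y\<close>, so a subsequence converges to a curve with that same constant. The
  lower bound on the distance to the complement passes to the limit \<open>d\<close>. It shows both that the
  limit curve stays in the set where \<open>d\<close> is positive and, as \<open>d\<close> is 1-Lipschitz and vanishes on
  the frontier, that the curve keeps the required distance from the frontier.\<close>

lemma uniform_domain_limit:
  fixes \<Omega>s :: "nat \<Rightarrow> 'a::euclidean_space set"
  assumes "0 < M" and unif: "\<And>i. uniform_domain M (\<Omega>s i)"
    and bdd: "\<And>i. \<Omega>s i \<subseteq> ball 0 R"
    and d: "\<And>x. (\<lambda>i. infdist x (- \<Omega>s i)) \<longlonglongrightarrow> d x"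
    and ne: "{x. 0 < d x} \<noteq> {}"
  shows "uniform_domain M {x. 0 < d x}"
proof (rule uniform_domain_if_lipschitz_curves)
  let ?\<Omega> = "{x. 0 < d x}"
  note d_lip = infdist_limit_lipschitz[OF d]
  show op: "open ?\<Omega>" using d by (rule open_positive_infdist_limit)
  show "?\<Omega> \<noteq> {}" by (rule ne)
  have notUNIV: "\<Omega>s i \<noteq> UNIV" for i
    using bdd[of i] not_bounded_UNIV bounded_subset[OF bounded_ball] by metis
  fix x y assume xy: "x \<in> ?\<Omega>" "y \<in> ?\<Omega>"
  obtain N where N: "\<And>i. i \<ge> N \<Longrightarrow> x \<in> \<Omega>s i \<and> y \<in> \<Omega>s i"
    using eventually_conj[OF eventually_mem_if_infdist_limit_pos[OF d, of x]
      eventually_mem_if_infdist_limit_pos[OF d, of y]] xy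
    unfolding mem_Collect_eq eventually_sequentially by blast
  have "\<exists>h :: real \<Rightarrow> 'a. (M * dist x y)-lipschitz_on {0..1} h \<and> h 0 = x \<and> h 1 = y \<and> h ` {0..1} \<subseteq> \<Omega>s (N + n) \<and>
      (\<forall>t\<in>{0..1}. 1 / M * min (dist (h t) x) (dist (h t) y) \<le> infdist (h t) (- \<Omega>s (N + n)))" for n
  proof -
    have "x \<in> \<Omega>s (N + n)" "y \<in> \<Omega>s (N + n)" using N[of "N + n"] by auto
    then show ?thesis
      by (rule uniform_domain_lipschitz_curve[OF unif notUNIV less_imp_le[OF \<open>0 < M\<close>]]) blast
  qed
  then obtain h :: "nat \<Rightarrow> real \<Rightarrow> 'a" where h: "\<And>n. (M * dist x y)-lipschitz_on {0..1} (h n)" "\<And>n. h n 0 = x" "\<And>n. h n 1 = y"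
      "\<And>n. h n ` {0..1} \<subseteq> \<Omega>s (N + n)"
      "\<And>n t. t \<in> {0..1} \<Longrightarrow>
        1 / M * min (dist (h n t) x) (dist (h n t) y) \<le> infdist (h n t) (- \<Omega>s (N + n))"
    by metis
  have bdd_h: "norm (h n t) \<le> R" if "t \<in> {0..1}" for n t
    using h(4)[of n] bdd[of "N + n"] that by fastforce
  obtain g and k where k: "strict_mono (k :: nat \<Rightarrow> nat)" and g: "(M * dist x y)-lipschitz_on {0..1} g"
    "\<And>t. t \<in> {0..1} \<Longrightarrow> (\<lambda>n. h (k n) t) \<longlonglongrightarrow> g t"
    by (rule lipschitz_sequence_convergent_subsequence[where F = h, OF compact_Icc h(1) bdd_h]) blast+
  have "g 0 = x" "g 1 = y"
    using g(2)[of 0] g(2)[of 1] by (auto simp: h LIMSEQ_const_iff)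
  have cork: "1 / M * min (dist (g t) x) (dist (g t) y) \<le> d (g t)" if t: "t \<in> {0..1}" for t
  proof -
    have "1 / M * min (dist (h (k n) t) x) (dist (h (k n) t) y)
        \<le> infdist (g t) (- \<Omega>s (N + k n)) + dist (h (k n) t) (g t)" for n
      using h(5)[OF t, of "k n"] infdist_triangle[of "h (k n) t" "- \<Omega>s (N + k n)" "g t"] by linarith
    moreover have "(\<lambda>n. 1 / M * min (dist (h (k n) t) x) (dist (h (k n) t) y))
        \<longlonglongrightarrow> 1 / M * min (dist (g t) x) (dist (g t) y)"
      by (intro tendsto_intros tendsto_min g(2) t)
    moreover have "(\<lambda>n. infdist (g t) (- \<Omega>s (N + k n)) + dist (h (k n) t) (g t))
        \<longlonglongrightarrow> d (g t) + dist (g t) (g t)"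
    proof (intro tendsto_intros g(2) t)
      have "strict_mono (\<lambda>n. N + k n)" using k by (simp add: strict_mono_def)
      from LIMSEQ_subseq_LIMSEQ[OF d this]
      show "(\<lambda>n. infdist (g t) (- \<Omega>s (N + k n))) \<longlonglongrightarrow> d (g t)" by (simp add: o_def)
    qed
    ultimately have "1 / M * min (dist (g t) x) (dist (g t) y) \<le> d (g t) + dist (g t) (g t)"
      by (intro LIMSEQ_le) auto
    then show ?thesis by simp
  qed
  show "\<exists>h :: real \<Rightarrow> 'a. (M * dist x y)-lipschitz_on {0..1} h \<and> h 0 = x \<and> h 1 = y \<and> h ` {0..1} \<subseteq> ?\<Omega> \<and>
        (\<forall>t\<in>{0..1}. \<forall>z\<in>frontier ?\<Omega>. 1 / M * min (dist (h t) x) (dist (h t) y) \<le> dist (h t) z)"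
  proof (intro exI[of _ g] conjI ballI)
    show "g ` {0..1} \<subseteq> ?\<Omega>"
    proof
      fix p assume "p \<in> g ` {0..1}"
      then obtain t where t: "t \<in> {0..1}" "p = g t" by auto
      \<comment> \<open>Away from the endpoints the lower bound is strictly positive; the endpoints lie in
        the set by assumption.\<close>
      show "p \<in> ?\<Omega>"
      proof (cases "p = x \<or> p = y")
        case False
        then have "0 < 1 / M * min (dist p x) (dist p y)" using \<open>0 < M\<close> by simp
        with cork[OF t(1)] t(2) show ?thesis by simp
      qed (use xy in auto)
    qed
    fix t :: real and z :: 'a assume t: "t \<in> {0..1}" and z: "z \<in> frontier ?\<Omega>"
    have "d z \<le> 0" using z op by (auto simp: frontier_def interior_open)
    then have "d (g t) \<le> dist (g t) z" using d_lip[of "g t" z] by linarith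
    with cork[OF t] show "1 / M * min (dist (g t) x) (dist (g t) y) \<le> dist (g t) z" by linarith
  qed fact+
qed

section \<open>Sets of density bounded away from one\<close>

text \<open>Enclose \<open>S\<close> in an open set \<open>T\<close> of almost the same measure and select, by Vitali's theorem,
  disjoint balls centred in \<open>S\<close> and contained in \<open>T\<close> that cover almost all of \<open>S\<close>. Since \<open>S\<close>
  fills at most the fraction \<open>c\<close> of each ball, its measure is at most \<open>c\<close> times that of \<open>T\<close>,
  which is impossible for positive measure.\<close>

lemma negligible_if_density_le:
  fixes S :: "'a::euclidean_space set"
  assumes S: "S \<in> lmeasurable" and "c < 1" "0 < r0"
    and dens: "\<And>x r. x \<in> S \<Longrightarrow> 0 < r \<Longrightarrow> r < r0
      \<Longrightarrow> measure lebesgue (S \<inter> ball x r) \<le> c * measure lebesgue (ball x r)"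
  shows "negligible S"
proof (rule ccontr)
  let ?\<mu> = "measure lebesgue :: 'a set \<Rightarrow> real"
  assume "\<not> negligible S"
  then have pos: "0 < ?\<mu> S"
    using S by (simp add: negligible_iff_measure zero_less_measure_iff)
  then obtain x0 where "x0 \<in> S" by (metis all_not_in_conv less_irrefl measure_empty)
  have "0 \<le> c"
  proof -
    have "0 < r0 / 2" "r0 / 2 < r0" using \<open>0 < r0\<close> by auto
    with dens[OF \<open>x0 \<in> S\<close> this] have "0 \<le> c * ?\<mu> (ball x0 (r0 / 2))"
      by (meson measure_nonneg order_trans)
    then show ?thesis
      using mult_neg_pos[of c "?\<mu> (ball x0 (r0 / 2))"] \<open>0 < r0\<close>
      by (force simp: content_ball_pos)
  qed
  \<comment> \<open>The final estimate is \<open>\<mu> S \<le> c * (\<mu> S + e)\<close>, that is, \<open>(1 - c) * \<mu> S \<le> c * e\<close>;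
    for this value of \<open>e\<close> it reads \<open>e \<le> c * e\<close>.\<close>
  define e where "e = (1 - c) * ?\<mu> S"
  have "e > 0" using pos \<open>c < 1\<close> by (simp add: e_def)
  obtain T where T: "open T" "S \<subseteq> T" "T - S \<in> lmeasurable" "emeasure lebesgue (T - S) < ennreal e"
    using sets_lebesgue_outer_open[of S e] S \<open>e > 0\<close> by blast
  have T_meas: "T \<in> lmeasurable"
    using fmeasurable.Un[OF T(3) S] T(2) by (simp add: Un_absorb2)
  have "?\<mu> (T - S) < e"
    using T(4) T(3) \<open>e > 0\<close> by (simp add: emeasure_eq_measure2 ennreal_less_iff)
  then have mT: "?\<mu> T < ?\<mu> S + e"
    using measurable_measure_Diff[OF T_meas _ T(2)] S by (simp add: fmeasurableD)
  define K where "K = {(x, r). x \<in> S \<and> 0 < r \<and> r < r0 \<and> ball x r \<subseteq> T}"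
  have "\<exists>i. i \<in> K \<and> x \<in> ball (fst i) (snd i) \<and> snd i < d" if xd: "x \<in> S" "0 < d" for x d
  proof -
    obtain k where k: "k > 0" "ball x k \<subseteq> T" using T xd by (meson openE subsetD)
    define r where "r = min k (min d r0) / 2"
    have r: "0 < r" "r < k" "r < d" "r < r0"
      using k xd \<open>0 < r0\<close> by (auto simp: r_def min_def)
    then have "ball x r \<subseteq> T" using k(2) subset_ball[of r k x] by auto
    then show ?thesis using r xd by (intro exI[of _ "(x, r)"]) (auto simp: K_def)
  qed
  then obtain C where C: "countable C" "C \<subseteq> K"
      "pairwise (\<lambda>i j. disjnt (ball (fst i) (snd i)) (ball (fst j) (snd j))) C"
      "negligible (S - (\<Union>i\<in>C. ball (fst i) (snd i)))"
    using Vitali_covering_theorem_balls[of S K fst snd] by blast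
  let ?B = "\<lambda>i. ball (fst i) (snd i) :: 'a set"
  let ?U = "\<Union>i\<in>C. ?B i"
  have fin: "?\<mu> (\<Union>i\<in>F. S \<inter> ?B i) \<le> c * ?\<mu> T" if F: "F \<subseteq> C" "finite F" for F
  proof -
    have dj: "disjoint_family_on ?B F"
      using C(3) F(1) unfolding disjoint_family_on_def pairwise_def disjnt_def by blast
    have "?\<mu> (\<Union>i\<in>F. S \<inter> ?B i) \<le> (\<Sum>i\<in>F. ?\<mu> (S \<inter> ?B i))"
      using S F by (intro measure_UNION_le) auto
    also have "\<dots> \<le> (\<Sum>i\<in>F. c * ?\<mu> (?B i))"
      using C(2) F(1) dens by (intro sum_mono) (auto simp: K_def)
    also have "\<dots> = c * ?\<mu> (\<Union>i\<in>F. ?B i)"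
      using F dj by (subst measure_finite_Union) (auto simp: sum_distrib_left emeasure_lborel_ball_finite[THEN less_imp_neq, simplified])
    also have "\<dots> \<le> c * ?\<mu> T"
    proof (rule mult_left_mono[OF measure_mono_fmeasurable \<open>0 \<le> c\<close>])
      show "(\<Union>i\<in>F. ?B i) \<subseteq> T" using C(2) F(1) by (fastforce simp: K_def)
    qed (use T_meas F in auto)
    finally show ?thesis .
  qed
  have "?\<mu> S = ?\<mu> (\<Union>i\<in>C. S \<inter> ?B i)"
  proof (rule measure_negligible_symdiff[symmetric])
    show "S \<in> lmeasurable" by fact
    show "negligible (S - (\<Union>i\<in>C. S \<inter> ?B i) \<union> ((\<Union>i\<in>C. S \<inter> ?B i) - S))"
      by (rule negligible_subset[OF C(4)]) auto
  qed
  also have "\<dots> \<le> c * ?\<mu> T"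
  proof (rule measure_UN_bound[OF C(1)])
  qed (use fin S in auto)
  finally have "?\<mu> S \<le> c * ?\<mu> T" .
  also have "\<dots> \<le> c * (?\<mu> S + e)" using mT \<open>0 \<le> c\<close> by (intro mult_left_mono) auto
  finally have "(1 - c) * ?\<mu> S \<le> c * e" by (simp add: algebra_simps)
  then have "e \<le> c * e" by (simp add: e_def)
  with \<open>e > 0\<close> \<open>c < 1\<close> show False by simp
qed

section \<open>Identification of the limit\<close>

lemma L1_set_convergence_iff:
  "L1_set_convergence A D \<longleftrightarrow> (\<forall>i. A i \<in> lmeasurable) \<and> D \<in> lmeasurable \<and>
     (\<lambda>i. measure lebesgue ((A i - D) \<union> (D - A i))) \<longlonglongrightarrow> 0"
proof -
  have meas: "integrable lebesgue (indicat_real S) \<longleftrightarrow> S \<in> lmeasurable" for S :: "'a set"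
    by (simp add: lmeasurable_iff_integrable)
  have "(LINT x|lebesgue. \<bar>indicat_real S x - indicat_real T x\<bar>) = measure lebesgue ((S - T) \<union> (T - S))"
    for S T :: "'a set"
  proof -
    have "\<bar>indicat_real S x - indicat_real T x\<bar> = indicat_real ((S - T) \<union> (T - S)) x" for x
      by (auto simp: indicator_def)
    then show ?thesis by simp
  qed
  then show ?thesis by (simp add: L1_set_convergence_def meas)
qed

lemma L1_set_convergence_measure:
  assumes "L1_set_convergence A D"
  shows "(\<lambda>i. measure lebesgue (A i - D)) \<longlonglongrightarrow> 0" "(\<lambda>i. measure lebesgue (D - A i)) \<longlonglongrightarrow> 0"
proof -
  have meas: "\<And>i. A i \<in> lmeasurable" "D \<in> lmeasurable"
    and lim: "(\<lambda>i. measure lebesgue ((A i - D) \<union> (D - A i))) \<longlonglongrightarrow> 0"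
    using assms by (auto simp: L1_set_convergence_iff)
  have m: "A i - D \<in> lmeasurable" "D - A i \<in> lmeasurable" for i
    using meas by (auto intro: fmeasurable.Diff)
  show "(\<lambda>i. measure lebesgue (A i - D)) \<longlonglongrightarrow> 0"
    by (rule tendsto_sandwich[OF _ _ tendsto_const lim])
      (use m in \<open>auto intro!: measure_mono_fmeasurable always_eventually\<close>)
  show "(\<lambda>i. measure lebesgue (D - A i)) \<longlonglongrightarrow> 0"
    by (rule tendsto_sandwich[OF _ _ tendsto_const lim])
      (use m in \<open>auto intro!: measure_mono_fmeasurable always_eventually\<close>)
qed

lemma L1_set_convergence_negligible_cong:
  assumes conv: "L1_set_convergence A D" and neg: "negligible (\<Omega> - D)" "negligible (D - \<Omega>)"
  shows "L1_set_convergence A \<Omega>"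
proof -
  have meas: "\<And>i. A i \<in> lmeasurable" "D \<in> lmeasurable"
    and lim: "(\<lambda>i. measure lebesgue ((A i - D) \<union> (D - A i))) \<longlonglongrightarrow> 0"
    using conv by (auto simp: L1_set_convergence_iff)
  have N: "negligible ((\<Omega> - D) \<union> (D - \<Omega>))" using neg by (rule negligible_Un)
  have "\<Omega> \<in> lmeasurable"
    using lmeasurable_negligible_symdiff[OF meas(2), of \<Omega>] N by (simp add: Un_commute)
  moreover have "measure lebesgue ((A i - \<Omega>) \<union> (\<Omega> - A i)) = measure lebesgue ((A i - D) \<union> (D - A i))" for i
  proof (rule measure_negligible_symdiff)
    show "(A i - D) \<union> (D - A i) \<in> lmeasurable" using meas by auto
    show "negligible ((A i - D \<union> (D - A i)) - (A i - \<Omega> \<union> (\<Omega> - A i)) \<union>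
        ((A i - \<Omega> \<union> (\<Omega> - A i)) - (A i - D \<union> (D - A i))))"
      by (rule negligible_subset[OF N]) auto
  qed
  ultimately show ?thesis using meas lim by (simp add: L1_set_convergence_iff)
qed

text \<open>For fixed \<open>m\<close>, the points that lie in \<open>A i\<close> for all \<open>i \<ge> m\<close> but not in \<open>D\<close> form a subset
  of each \<open>A i - D\<close> with \<open>i \<ge> m\<close>, and the measures of these sets tend to zero.\<close>

lemma negligible_Diff_if_eventually_covered:
  assumes conv: "L1_set_convergence A D"
    and ev: "\<And>x. x \<in> S \<Longrightarrow> \<forall>\<^sub>F i in sequentially. x \<in> A i"
  shows "negligible (S - D)"
proof -
  have meas: "\<And>i. A i \<in> lmeasurable" "D \<in> lmeasurable"
    using conv by (auto simp: L1_set_convergence_iff)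
  define T where "T m = (\<Inter>i\<in>{m..}. A i) - D" for m :: nat
  have "negligible (T m)" for m
  proof -
    have T_sets: "T m \<in> sets lebesgue"
      unfolding T_def using meas by (intro sets.Diff sets.countable_INT') auto
    have sub: "T m \<subseteq> A i - D" if "i \<ge> m" for i using that by (auto simp: T_def)
    have AD: "A i - D \<in> lmeasurable" for i using meas by (auto intro: fmeasurable.Diff)
    have "measure lebesgue (T m) \<le> 0"
    proof (rule LIMSEQ_le_const[OF L1_set_convergence_measure(1)[OF conv]])
      show "\<exists>N. \<forall>n\<ge>N. measure lebesgue (T m) \<le> measure lebesgue (A n - D)"
        using measure_mono_fmeasurable[OF sub T_sets AD] by blast
    qed
    moreover have "T m \<in> lmeasurable"
      using fmeasurableI2[OF AD sub[OF order_refl] T_sets] .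
    ultimately show ?thesis
      by (simp add: negligible_iff_measure order_antisym)
  qed
  then have "negligible (\<Union>m. T m)" by (rule negligible_Union_nat)
  moreover have "S - D \<subseteq> (\<Union>m. T m)"
  proof
    fix x assume x: "x \<in> S - D"
    with ev obtain m where "\<And>i. i \<ge> m \<Longrightarrow> x \<in> A i" unfolding eventually_sequentially by blast
    with x show "x \<in> (\<Union>m. T m)" by (auto simp: T_def)
  qed
  ultimately show ?thesis by (rule negligible_subset)
qed

text \<open>This turns the lower bound on the volumes of the domains into a lower bound on their extent: none
  of them fits into a ball of radius less than \<open>r0\<close>.\<close>

lemma uniform_ball_measure_less:
  assumes "0 < c"
  obtains r0 where "0 < r0" "\<And>(z::'a::euclidean_space) r. 0 \<le> r \<Longrightarrow> r < r0 \<Longrightarrow> measure lebesgue (ball z r) < c"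
proof -
  have "((\<lambda>r. unit_ball_vol (DIM('a)) * r ^ DIM('a)) \<longlongrightarrow> unit_ball_vol (DIM('a)) * 0 ^ DIM('a)) (at_right (0::real))"
    by (intro tendsto_intros)
  moreover have "(0::real) ^ DIM('a) = 0" by simp
  ultimately have "\<forall>\<^sub>F r in at_right (0::real). unit_ball_vol (DIM('a)) * r ^ DIM('a) < c"
    using assms by (intro order_tendstoD(2)) auto
  then obtain b :: real where b: "0 < b" "\<And>r. 0 < r \<Longrightarrow> r < b \<Longrightarrow> unit_ball_vol (DIM('a)) * r ^ DIM('a) < c"
    unfolding eventually_at_right_field by blast
  show ?thesis
  proof (rule that[OF b(1)])
    fix z :: 'a and r :: real assume r: "0 \<le> r" "r < b"
    have "measure lebesgue (ball z r) = unit_ball_vol (DIM('a)) * r ^ DIM('a)"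
      using content_ball[OF r(1), of z] by simp
    with b(2)[of r] r assms show "measure lebesgue (ball z r) < c" by (cases "r = 0") auto
  qed
qed

text \<open>It is shown that for \<open>x\<close> in \<open>D\<close>, every small ball around \<open>x\<close> of radius \<open>r\<close> contains a ball of
  radius \<open>r / (4 * M)\<close> that \<open>D - {x. 0 < d x}\<close> misses up to a null set; the density criterion
  then applies. There are two cases. If infinitely many of the domains meet the ball of radius
  \<open>r / 2\<close> around \<open>x\<close>, then, being too large to fit into a ball of radius \<open>r\<close>, each of them
  contains a corkscrew point near \<open>x\<close>; a limit \<open>p0\<close> of such points has \<open>d p0 \<ge> r / (4 * M)\<close>, so
  \<open>d\<close> is positive on a whole ball around it. Otherwise convergence in \<open>L\<^sup>1\<close> forces \<open>D\<close> itself
  to be null in the ball of radius \<open>r / 2\<close>.\<close>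

lemma negligible_Diff_uniform_domain_limit:
  fixes \<Omega>s :: "nat \<Rightarrow> 'a::euclidean_space set"
  assumes "1 \<le> M" "0 < c" and unif: "\<And>i. uniform_domain M (\<Omega>s i)" "\<And>i. \<Omega>s i \<noteq> UNIV"
    and vol: "\<And>i. c \<le> measure lebesgue (\<Omega>s i)"
    and d: "\<And>x. (\<lambda>i. infdist x (- \<Omega>s i)) \<longlonglongrightarrow> d x"
    and op: "open {x. 0 < d x}"
    and conv: "L1_set_convergence \<Omega>s D"
  shows "negligible (D - {x. 0 < d x})"
proof -
  let ?\<Omega> = "{x. 0 < d x}"
  let ?\<mu> = "measure lebesgue :: 'a set \<Rightarrow> real"
  have meas: "\<And>i. \<Omega>s i \<in> lmeasurable" "D \<in> lmeasurable"
    using conv by (auto simp: L1_set_convergence_iff)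
  have DO: "D - ?\<Omega> \<in> lmeasurable"
    using meas(2) op by (intro fmeasurable_Diff) (auto intro: borel_open)
  note d_lip = infdist_limit_lipschitz[OF d]
  obtain r0 where r0: "0 < r0" "\<And>(z::'a) r. 0 \<le> r \<Longrightarrow> r < r0 \<Longrightarrow> ?\<mu> (ball z r) < c"
    using uniform_ball_measure_less[OF \<open>0 < c\<close>] by blast
  define q where "q = (1 / (4 * M)) ^ DIM('a)"
  have q: "0 < q" using \<open>1 \<le> M\<close> by (simp add: q_def)
  show ?thesis
  proof (rule negligible_if_density_le[OF DO _ r0(1)])
    show "1 - q < 1" using q by simp
    fix x r assume x: "x \<in> D - ?\<Omega>" and r: "0 < r" "r < r0"
    define s where "s = r / (4 * M)"
    have s: "0 < s" "s \<le> r / 4" using r \<open>1 \<le> M\<close> by (auto simp: s_def field_simps)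
    have "\<exists>p. ball p s \<subseteq> ball x r \<and> negligible ((D - ?\<Omega>) \<inter> ball p s)"
    proof (cases "\<exists>\<^sub>F i in sequentially. \<Omega>s i \<inter> ball x (r / 2) \<noteq> {}")
      case True
      then have "\<exists>\<^sub>F i in sequentially. \<exists>p. p \<in> cball x (3 * r / 4) \<and> r / (4 * M) \<le> infdist p (- \<Omega>s i)"
      proof (rule frequently_elim1)
        fix i assume "\<Omega>s i \<inter> ball x (r / 2) \<noteq> {}"
        then obtain z where z: "z \<in> \<Omega>s i" "dist x z < r / 2" by auto
        obtain w where w: "w \<in> \<Omega>s i" "r \<le> dist z w"
        proof -
          have "\<not> \<Omega>s i \<subseteq> ball z r"
            using measure_mono_fmeasurable[of "\<Omega>s i" "ball z r" lebesgue] meas(1)[of i] vol[of i]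
              r0(2)[of r z] r by (auto simp: fmeasurableD)
          then obtain w where "w \<in> \<Omega>s i" "w \<notin> ball z r" by blast
          then show ?thesis by (intro that[of w]) auto
        qed
        obtain p where p: "dist z p = r / 4" "r / (4 * M) \<le> infdist p (- \<Omega>s i)"
          using uniform_domain_corkscrew[OF unif _ z(1) w(1) r(1) w(2)] \<open>1 \<le> M\<close> by auto
        have "dist x p \<le> 3 * r / 4" using dist_triangle[of x p z] z(2) p(1) by linarith
        with p(2) show "\<exists>p. p \<in> cball x (3 * r / 4) \<and> r / (4 * M) \<le> infdist p (- \<Omega>s i)" by auto
      qed
      then have "\<exists>i>n. \<exists>p. p \<in> cball x (3 * r / 4) \<and> r / (4 * M) \<le> infdist p (- \<Omega>s i)" for n
        unfolding frequently_sequentially by (meson Suc_le_eq)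
      then obtain k :: "nat \<Rightarrow> nat" where k: "strict_mono k"
          "\<And>n. \<exists>p. p \<in> cball x (3 * r / 4) \<and> r / (4 * M) \<le> infdist p (- \<Omega>s (k n))"
        using infinite_enumerate[of "{i. \<exists>p. p \<in> cball x (3 * r / 4) \<and> r / (4 * M) \<le> infdist p (- \<Omega>s i)}"]
        unfolding infinite_nat_iff_unbounded by blast
      then obtain p where p: "\<And>n. p n \<in> cball x (3 * r / 4)"
          "\<And>n. r / (4 * M) \<le> infdist (p n) (- \<Omega>s (k n))" by metis
      obtain p0 l where l: "p0 \<in> cball x (3 * r / 4)" "strict_mono (l :: nat \<Rightarrow> nat)" "(p \<circ> l) \<longlonglongrightarrow> p0"
        using compact_cball[of x "3 * r / 4"] p(1) unfolding compact_def by blast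
      have "r / (4 * M) \<le> d p0"
      proof -
        have "r / (4 * M) - dist (p (l n)) p0 \<le> infdist p0 (- \<Omega>s (k (l n)))" for n
          using p(2)[of "l n"] infdist_triangle[of "p (l n)" "- \<Omega>s (k (l n))" p0] by linarith
        moreover have "(\<lambda>n. r / (4 * M) - dist (p (l n)) p0) \<longlonglongrightarrow> r / (4 * M) - dist p0 p0"
          using l(3) by (intro tendsto_intros) (simp add: o_def)
        moreover have "(\<lambda>n. infdist p0 (- \<Omega>s (k (l n)))) \<longlonglongrightarrow> d p0"
          using LIMSEQ_subseq_LIMSEQ[OF LIMSEQ_subseq_LIMSEQ[OF d k(1)] l(2)] by (simp add: o_def)
        ultimately have "r / (4 * M) - dist p0 p0 \<le> d p0" by (intro LIMSEQ_le) auto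
        then show ?thesis by simp
      qed
      have "ball p0 s \<subseteq> ?\<Omega>"
      proof
        fix y assume "y \<in> ball p0 s"
        then have "dist p0 y < d p0" using \<open>r / (4 * M) \<le> d p0\<close> by (simp add: s_def)
        then show "y \<in> ?\<Omega>" using d_lip[of p0 y] by (simp add: abs_le_iff)
      qed
      then have "(D - ?\<Omega>) \<inter> ball p0 s = {}" by blast
      moreover have "ball p0 s \<subseteq> ball x r"
      proof
        fix y assume "y \<in> ball p0 s"
        then show "y \<in> ball x r" using dist_triangle[of x y p0] l(1) s by auto
      qed
      ultimately show ?thesis by (metis negligible_empty)
    next
      case False
      then have ev: "\<forall>\<^sub>F i in sequentially. \<Omega>s i \<inter> ball x (r / 2) = {}"
        by (simp add: not_frequently)
      have B: "D \<inter> ball x (r / 2) \<in> lmeasurable" using meas(2) by auto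
      have "?\<mu> (D \<inter> ball x (r / 2)) \<le> 0"
      proof (rule tendsto_lowerbound[OF L1_set_convergence_measure(2)[OF conv]])
        show "\<forall>\<^sub>F i in sequentially. ?\<mu> (D \<inter> ball x (r / 2)) \<le> ?\<mu> (D - \<Omega>s i)"
          using ev
        proof eventually_elim
          case (elim i)
          show ?case
            by (rule measure_mono_fmeasurable)
              (use elim meas B in \<open>auto intro: fmeasurable.Diff simp: fmeasurableD\<close>)
        qed
      qed simp
      then have "negligible (D \<inter> ball x (r / 2))"
        using B by (simp add: negligible_iff_measure order_antisym)
      moreover have "ball x s \<subseteq> ball x (r / 2)" using s by (intro subset_ball) auto
      ultimately have "negligible ((D - ?\<Omega>) \<inter> ball x s)"
        by (meson Diff_subset Int_mono negligible_subset)
      moreover have "ball x s \<subseteq> ball x r" using s by (intro subset_ball) auto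
      ultimately show ?thesis by blast
    qed
    then obtain p where p: "ball p s \<subseteq> ball x r" "negligible ((D - ?\<Omega>) \<inter> ball p s)" by blast
    have "?\<mu> ((D - ?\<Omega>) \<inter> ball x r) = ?\<mu> ((D - ?\<Omega>) \<inter> ball x r - ball p s)"
      by (rule measure_negligible_symdiff[symmetric])
        (use DO in \<open>auto intro: negligible_subset[OF p(2)]\<close>)
    also have "\<dots> \<le> ?\<mu> (ball x r - ball p s)"
    proof (intro measure_mono_fmeasurable)
      show "(D - ?\<Omega>) \<inter> ball x r - ball p s \<in> sets lebesgue"
        by (intro sets.Diff[OF sets.Int[OF fmeasurableD[OF DO]]]) auto
    qed (auto intro: fmeasurable.Diff)
    also have "\<dots> = ?\<mu> (ball x r) - ?\<mu> (ball p s)"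
      by (rule measurable_measure_Diff) (use p in auto)
    also have "\<dots> = (1 - q) * ?\<mu> (ball x r)"
      using content_ball[of r x] content_ball[of s p] r s
      by (simp add: s_def q_def power_divide algebra_simps)
    finally show "?\<mu> ((D - ?\<Omega>) \<inter> ball x r) \<le> (1 - q) * ?\<mu> (ball x r)" .
  qed
qed

section \<open>Closure of the class of uniform domains\<close>

theorem theorem3p5:
  fixes M R\<^sub>0 c\<^sub>0 :: real
    and \<Omega>s :: "nat \<Rightarrow> (real ^ 'n) set"
    and D :: "(real ^ 'n) set"
  assumes "M \<ge> 1" and "R\<^sub>0 > 0" and "c\<^sub>0 > 0"
    and "\<And>i. uniform_domain M (\<Omega>s i)"
    and "\<And>i. \<Omega>s i \<subseteq> ball 0 R\<^sub>0"
    and "\<And>i. measure lebesgue (\<Omega>s i) \<ge> c\<^sub>0"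
    and "L1_set_convergence \<Omega>s D"
  shows "\<exists>\<Omega> :: (real ^ 'n) set. uniform_domain M \<Omega> \<and> L1_set_convergence \<Omega>s \<Omega>"
proof -
  \<comment> \<open>A point outside every domain keeps the distances to the complements bounded.\<close>
  obtain z0 :: "real ^ 'n" where z0: "norm z0 = R\<^sub>0"
    using vector_choose_size[of R\<^sub>0] \<open>R\<^sub>0 > 0\<close> by auto
  then have z0_notin: "z0 \<in> - \<Omega>s i" for i using assms(5)[of i] by fastforce
  then have notUNIV: "\<Omega>s i \<noteq> UNIV" for i by blast
  obtain g k where k: "strict_mono (k :: nat \<Rightarrow> nat)"
    and g: "\<And>x. x \<in> cball 0 R\<^sub>0 \<Longrightarrow> (\<lambda>n. infdist x (- \<Omega>s (k n))) \<longlonglongrightarrow> g x"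
  proof (rule lipschitz_sequence_convergent_subsequence[of "cball 0 R\<^sub>0" 1 "\<lambda>i x. infdist x (- \<Omega>s i)" "2 * R\<^sub>0"])
    show "1-lipschitz_on (cball 0 R\<^sub>0) (\<lambda>x. infdist x (- \<Omega>s n))" for n
      by (rule lipschitz_onI) (auto simp: dist_real_def infdist_triangle_abs)
    fix n and x :: "real ^ 'n" assume x: "x \<in> cball 0 R\<^sub>0"
    have "infdist x (- \<Omega>s n) \<le> dist x z0" using z0_notin by (rule infdist_le)
    also have "\<dots> \<le> 2 * R\<^sub>0" using norm_triangle_ineq4[of x z0] x z0 by (simp add: dist_norm)
    finally show "norm (infdist x (- \<Omega>s n)) \<le> 2 * R\<^sub>0" by (simp add: infdist_nonneg)
  qed (auto simp: compact_cball)
  \<comment> \<open>Outside the large ball all the distances to the complements are zero.\<close>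
  define d where "d x = (if x \<in> cball 0 R\<^sub>0 then g x else 0)" for x
  have d: "(\<lambda>n. infdist x (- \<Omega>s (k n))) \<longlonglongrightarrow> d x" for x
  proof (cases "x \<in> cball 0 R\<^sub>0")
    case False
    then have "x \<in> - \<Omega>s i" for i using assms(5)[of i] by fastforce
    then show ?thesis using False by (simp add: d_def)
  qed (use g in \<open>auto simp: d_def\<close>)
  let ?\<Omega> = "{x. 0 < d x}"
  have conv: "L1_set_convergence (\<lambda>n. \<Omega>s (k n)) D"
    using assms(7) LIMSEQ_subseq_LIMSEQ[OF _ k] unfolding L1_set_convergence_iff by (fastforce simp: o_def)
  have op: "open ?\<Omega>" using d by (rule open_positive_infdist_limit)
  have neg1: "negligible (?\<Omega> - D)"
    using conv
  proof (rule negligible_Diff_if_eventually_covered)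
    show "\<forall>\<^sub>F n in sequentially. x \<in> \<Omega>s (k n)" if "x \<in> ?\<Omega>" for x
      using that by (intro eventually_mem_if_infdist_limit_pos[OF d]) auto
  qed
  have neg2: "negligible (D - ?\<Omega>)"
    by (rule negligible_Diff_uniform_domain_limit[OF assms(1,3) assms(4) notUNIV assms(6) d op conv])
  have L1: "L1_set_convergence \<Omega>s ?\<Omega>"
    using assms(7) neg1 neg2 by (rule L1_set_convergence_negligible_cong)
  have "?\<Omega> \<noteq> {}"
  proof
    assume empty: "?\<Omega> = {}"
    have "(\<lambda>i. measure lebesgue (\<Omega>s i)) \<longlonglongrightarrow> 0"
      using L1_set_convergence_measure(1)[OF L1] unfolding empty by simp
    then have "c\<^sub>0 \<le> 0" by (rule LIMSEQ_le_const) (use assms(6) in blast)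
    with \<open>c\<^sub>0 > 0\<close> show False by simp
  qed
  then have "uniform_domain M ?\<Omega>"
    using assms(1) by (intro uniform_domain_limit[OF _ assms(4) assms(5) d]) auto
  with L1 show ?thesis by blast
qed

end
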